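(* Assume $\kappa>0$, $\phi_*:=\inf_{r\ge0}\phi(r)>0$ and $\phi_*M>\sigma\bar\theta$. Then for every solution of system (CSF), $\mathcal A(t):=\max_{i,j}|\mathbf v_i(t)-\mathbf v_j(t)|\to0$ exponentially fast, and exactly one of the following holds: either $\mathbf v_i(t)\to0$ for all $i$, or there exists a vector $\bar{\mathbf v}\in\mathbb R^n$ with $|\bar{\mathbf v}|=\bar\theta^{1/p}$ such that all $\mathbf v_i(t)$ converge to $\bar{\mathbf v}$ exponentially fast.
   Context: Fix integers $N\ge1$, $n\ge1$, masses $m_1,\dots,m_N>0$ with $M=\sum_i m_i$, parameters $\sigma>0$, $p>0$, $\kappa\ge0$, and a communication kernel $\phi:[0,\infty)\to(0,\infty)$ that is smooth, positive and non-increasing. Write $\phi_{ij}=\phi(|\mathbf x_i-\mathbf x_j|)$, with $|\cdot|$ the Euclidean norm on $\mathbb R^n$. System (CSF) is, for $i=1,\dots,N$, $$\dot{\mathbf x}_i=\mathbf v_i,\qquad \dot{\mathbf v}_i=\sum_{j=1}^N m_j\phi_{ij}(\mathbf v_j-\mathbf v_i)+\sigma(\theta_i-|\mathbf v_i|^p)\mathbf v_i,\qquad \dot\theta_i=\kappa\sum_{j=1}^N m_j\phi_{ij}(\theta_j-\theta_i),$$ with $\mathbf x_i,\mathbf v_i\in\mathbb R^n$ and initial values $\theta_i(0)>0$; solutions are considered for $t\ge0$. Set $\bar\theta=\frac1M\sum_i m_i\theta_i(0)$; this weighted average is conserved in time. *)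

theory Defs
  imports "HOL-Analysis.Analysis"
begin

definition smooth_on :: "real set \<Rightarrow> (real \<Rightarrow> real) \<Rightarrow> bool" where
  "smooth_on S f \<longleftrightarrow> (\<exists>D :: nat \<Rightarrow> real \<Rightarrow> real.
      (\<forall>x\<in>S. D 0 x = f x) \<and>
      (\<forall>k. \<forall>x\<in>S. (D k has_real_derivative D (Suc k) x) (at x within S)))"

definition comm_kernel :: "(real \<Rightarrow> real) \<Rightarrow> bool" where
  "comm_kernel \<phi> \<longleftrightarrow> smooth_on {0..} \<phi> \<and> (\<forall>r\<ge>0. \<phi> r > 0) \<and>
     (\<forall>r s. 0 \<le> r \<longrightarrow> r \<le> s \<longrightarrow> \<phi> s \<le> \<phi> r)"

definition CSF_solution ::
  "nat \<Rightarrow> (nat \<Rightarrow> real) \<Rightarrow> real \<Rightarrow> real \<Rightarrow> real \<Rightarrow> (real \<Rightarrow> real)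
   \<Rightarrow> (nat \<Rightarrow> real \<Rightarrow> real ^ 'n) \<Rightarrow> (nat \<Rightarrow> real \<Rightarrow> real ^ 'n) \<Rightarrow> (nat \<Rightarrow> real \<Rightarrow> real) \<Rightarrow> bool"
  where
  "CSF_solution N m \<sigma> p \<kappa> \<phi> x v \<theta> \<longleftrightarrow>
     (\<forall>i<N. \<forall>t\<ge>0.
        (x i has_vector_derivative v i t) (at t within {0..}) \<and>
        (v i has_vector_derivative
           ((\<Sum>j<N. (m j * \<phi> (norm (x i t - x j t))) *\<^sub>R (v j t - v i t))
            + (\<sigma> * (\<theta> i t - norm (v i t) powr p)) *\<^sub>R v i t)) (at t within {0..}) \<and>
        (\<theta> i has_real_derivative
           (\<kappa> * (\<Sum>j<N. m j * \<phi> (norm (x i t - x j t)) * (\<theta> j t - \<theta> i t)))) (at t within {0..}))"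

end

theory Submission
  imports Defs
begin

text \<open>
  By symmetry of the kernel the mean of the \<open>\<theta>\<^sub>i\<close> is conserved and their variance decays like
  $e^{-2\kappa\phi_* M t}$; then the energy $\sum_i m_i |v_i|^2$ stays bounded. For the variance $W$ of
  the velocities, monotonicity of the field $a \mapsto |a|^p a$ lets one discard the nonlinear friction,
  leaving $W' \le -2(\phi_* M - \sigma\bar\theta) W + O(e^{-rt})$, hence exponential alignment.
  The mean velocity $u$ then solves $u' = \sigma(\bar\theta - |u|^p) u + R$ with $R$ exponentially small.
  If $u$ does not tend to 0, at some late time $|u| \ge \delta$ while $R$ is too small to push $|u|$ below
  $\delta$ again; from then on $y = |u|^p$ satisfies a perturbed logistic equation
  $y' = p\sigma(\bar\theta - y) y + O(e^{-rt})$ with $y \ge \delta^p$, so $y \to \bar\theta$ exponentially,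
  $u'$ is exponentially small, and $u$ converges exponentially.
\<close>

section \<open>Exponential decay\<close>

text \<open>Constant and rate are existentially quantified, so later estimates need not track them.
  The bound is demanded on all of [0, \<infinity>); \<open>exp_decay_from\<close> supplies it when
  only late times are controlled.\<close>

definition exp_decay :: "(real \<Rightarrow> 'a::real_normed_vector) \<Rightarrow> bool" where
  "exp_decay f \<longleftrightarrow> (\<exists>C r. r > 0 \<and> (\<forall>t\<ge>0. norm (f t) \<le> C * exp (- r * t)))"

lemma exp_decayI:
  assumes "r > 0" "\<And>t. t \<ge> 0 \<Longrightarrow> norm (f t) \<le> C * exp (- r * t)"
  shows "exp_decay f"
  using assms unfolding exp_decay_def by blast

lemma exp_decayE:
  assumes "exp_decay f"
  obtains C r where "C > 0" "r > 0" "\<And>t. t \<ge> 0 \<Longrightarrow> norm (f t) \<le> C * exp (- r * t)"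
proof -
  from assms obtain C r where r: "r > 0" and b: "\<And>t. t \<ge> 0 \<Longrightarrow> norm (f t) \<le> C * exp (- r * t)"
    unfolding exp_decay_def by blast
  \<comment> \<open>The definition leaves the sign of \<open>C\<close> open; enlarging it to
    \<open>\<bar>C\<bar> + 1\<close> makes it strictly positive.\<close>
  have "norm (f t) \<le> (\<bar>C\<bar> + 1) * exp (- r * t)" if "t \<ge> 0" for t
    by (rule order_trans[OF b[OF that]]) (auto intro!: mult_right_mono)
  then show thesis using that[of "\<bar>C\<bar> + 1" r] r by simp
qed

lemma exp_decay_dominated:
  assumes g: "exp_decay g" and le: "\<And>t. t \<ge> 0 \<Longrightarrow> norm (f t) \<le> K * norm (g t)"
  shows "exp_decay f"
proof -
  obtain C r where *: "C > 0" "r > 0" "\<And>t. t \<ge> 0 \<Longrightarrow> norm (g t) \<le> C * exp (- r * t)"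
    using exp_decayE[OF g] by blast
  have "norm (f t) \<le> (\<bar>K\<bar> * C) * exp (- r * t)" if "t \<ge> 0" for t
  proof -
    have "K * norm (g t) \<le> \<bar>K\<bar> * norm (g t)"
      by (intro mult_right_mono) auto
    also have "\<dots> \<le> \<bar>K\<bar> * (C * exp (- r * t))"
      using *(3)[OF that] by (intro mult_left_mono) auto
    finally show ?thesis using le[OF that] by (simp add: mult.assoc)
  qed
  then show ?thesis using *(2) by (rule exp_decayI[rotated])
qed

lemma exp_decay_zero: "exp_decay (\<lambda>t. 0)"
  by (rule exp_decayI[of 1 _ 0]) auto

lemma exp_decay_add:
  assumes "exp_decay f" "exp_decay g"
  shows "exp_decay (\<lambda>t. f t + g t)"
proof -
  obtain C r where f: "C > 0" "r > 0" "\<And>t. t \<ge> 0 \<Longrightarrow> norm (f t) \<le> C * exp (- r * t)"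
    using exp_decayE[OF assms(1)] by blast
  obtain D s where g: "D > 0" "s > 0" "\<And>t. t \<ge> 0 \<Longrightarrow> norm (g t) \<le> D * exp (- s * t)"
    using exp_decayE[OF assms(2)] by blast
  have "norm (f t + g t) \<le> (C + D) * exp (- min r s * t)" if t: "t \<ge> 0" for t
  proof -
    have "C * exp (- r * t) \<le> C * exp (- min r s * t)" "D * exp (- s * t) \<le> D * exp (- min r s * t)"
      using f g t by (auto intro!: mult_left_mono mult_right_mono)
    then show ?thesis
      using norm_triangle_ineq[of "f t" "g t"] f(3)[OF t] g(3)[OF t] by (simp add: distrib_right)
  qed
  then show ?thesis using f(2) g(2) by (intro exp_decayI[of "min r s"]) auto
qed

lemma exp_decay_scaleR_left:
  assumes "exp_decay f" "\<And>t. t \<ge> 0 \<Longrightarrow> \<bar>a t\<bar> \<le> K"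
  shows "exp_decay (\<lambda>t. a t *\<^sub>R f t)"
  using assms(1) by (rule exp_decay_dominated[where K = K]) (auto intro!: mult_right_mono assms(2))

lemma exp_decay_sum:
  assumes "\<And>i. i \<in> A \<Longrightarrow> exp_decay (f i)"
  shows "exp_decay (\<lambda>t. \<Sum>i\<in>A. f i t)"
  using assms
  by (induction A rule: infinite_finite_induct) (auto intro: exp_decay_zero exp_decay_add)

lemma exp_decay_norm: "exp_decay (\<lambda>t. norm (f t)) \<longleftrightarrow> exp_decay f"
  by (simp add: exp_decay_def)

lemma exp_decay_bounded:
  assumes "exp_decay f"
  obtains C where "C > 0" "\<And>t. t \<ge> 0 \<Longrightarrow> norm (f t) \<le> C"
proof -
  obtain C r where *: "C > 0" "r > 0" "\<And>t. t \<ge> 0 \<Longrightarrow> norm (f t) \<le> C * exp (- r * t)"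
    using exp_decayE[OF assms] by blast
  have "norm (f t) \<le> C" if t: "t \<ge> 0" for t
  proof -
    have "C * exp (- r * t) \<le> C * 1" using * t by (intro mult_left_mono) auto
    then show ?thesis using *(3)[OF t] by simp
  qed
  then show thesis using that * by blast
qed

lemma exp_decay_sqrt:
  fixes f :: "real \<Rightarrow> real"
  assumes "exp_decay f"
  shows "exp_decay (\<lambda>t. sqrt (f t))"
proof -
  obtain C r where *: "C > 0" "r > 0" "\<And>t. t \<ge> 0 \<Longrightarrow> norm (f t) \<le> C * exp (- r * t)"
    using exp_decayE[OF assms] by blast
  have "norm (sqrt (f t)) \<le> sqrt C * exp (- (r/2) * t)" if "t \<ge> 0" for t
  proof -
    \<comment> \<open>In HOL \<open>sqrt\<close> is an odd function on the reals, so this holds for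
      either sign of \<open>f t\<close>. Taking the root then halves the decay rate.\<close>
    have "norm (sqrt (f t)) = sqrt \<bar>f t\<bar>" by (simp add: abs_if real_sqrt_minus)
    also have "\<dots> \<le> sqrt (C * exp (- r * t))" using *(3)[OF that] by (intro real_sqrt_le_mono) simp
    also have "\<dots> = sqrt C * exp (- (r/2) * t)"
      by (simp add: real_sqrt_mult exp_half_le2 real_sqrt_unique flip: exp_double)
    finally show ?thesis .
  qed
  then show ?thesis using *(2) by (intro exp_decayI[of "r/2"]) auto
qed

lemma exp_decay_tendsto_0:
  assumes "exp_decay f"
  shows "(f \<longlongrightarrow> 0) at_top"
proof -
  obtain C r where *: "C > 0" "r > 0" "\<And>t. t \<ge> 0 \<Longrightarrow> norm (f t) \<le> C * exp (- r * t)"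
    using exp_decayE[OF assms] by blast
  have "filterlim (\<lambda>t. - r * t) at_bot at_top"
    using *(2) by (intro filterlim_tendsto_neg_mult_at_bot[OF tendsto_const _ filterlim_ident]) auto
  then have "((\<lambda>t. C * exp (- r * t)) \<longlongrightarrow> C * 0) at_top"
    by (intro tendsto_mult tendsto_const filterlim_compose[OF exp_at_bot])
  then have "((\<lambda>t. C * exp (- r * t)) \<longlongrightarrow> 0) at_top" by simp
  then show ?thesis
    by (rule Lim_null_comparison[rotated]) (auto simp: eventually_at_top_linorder intro!: exI[of _ 0] *(3)[simplified])
qed

text \<open>Continuity bounds \<open>f\<close> by some \<open>B\<close> on the compact interval
  [0, T]. There exp(-r t) is at least exp(-r T), so this part is absorbed by adding
  \<open>B * exp (r * T)\<close> to the constant.\<close>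

lemma exp_decay_from:
  assumes "continuous_on {0..} f" "0 \<le> T" "r > 0"
    and b: "\<And>t. t \<ge> T \<Longrightarrow> norm (f t) \<le> C * exp (- r * t)"
  shows "exp_decay f"
proof -
  have "compact (f ` {0..T})"
    by (rule compact_continuous_image) (auto intro: continuous_on_subset[OF assms(1)])
  then obtain B where B: "B > 0" "\<And>t. t \<in> {0..T} \<Longrightarrow> norm (f t) \<le> B"
    using compact_imp_bounded bounded_pos by (metis image_eqI)
  have "norm (f t) \<le> (\<bar>C\<bar> + B * exp (r * T)) * exp (- r * t)" if t: "t \<ge> 0" for t
  proof (cases "t \<le> T")
    case True
    have "norm (f t) \<le> B * 1" using B t True by auto
    also have "\<dots> \<le> B * exp (r * T - r * t)"
      using B True \<open>r > 0\<close> by (intro mult_left_mono) auto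
    also have "\<dots> = (B * exp (r * T)) * exp (- r * t)" by (simp add: exp_diff exp_minus field_simps)
    also have "\<dots> \<le> (\<bar>C\<bar> + B * exp (r * T)) * exp (- r * t)" by (intro mult_right_mono) auto
    finally show ?thesis .
  next
    case False
    then have "norm (f t) \<le> C * exp (- r * t)" using b by auto
    also have "\<dots> \<le> (\<bar>C\<bar> + B * exp (r * T)) * exp (- r * t)"
      using B by (intro mult_right_mono) (auto intro: add_increasing2)
    finally show ?thesis .
  qed
  then show ?thesis using \<open>r > 0\<close> by (rule exp_decayI[rotated])
qed

section \<open>Calculus and differential inequalities on the half-line\<close>

text \<open>Solutions are differentiable within \<open>{0..}\<close>, whereas the monotonicity
  criterion asks for two-sided derivatives; the two notions agree at interior points.\<close>

lemma has_real_derivative_at_if_pos: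
  assumes "(f has_real_derivative D) (at t within {0..})" "t > 0"
  shows "(f has_real_derivative D) (at t)"
  using assms at_within_interior[of t "{0::real..}"] by (simp add: interior_real_atLeast)

lemma has_real_derivative_norm_power2:
  fixes f :: "real \<Rightarrow> 'a::real_inner"
  assumes "(f has_vector_derivative f') (at t within S)"
  shows "((\<lambda>t. (norm (f t))\<^sup>2) has_real_derivative 2 * inner (f t) f') (at t within S)"
  unfolding power2_norm_eq_inner
  using assms unfolding has_vector_derivative_def has_field_derivative_def
  by (auto intro!: derivative_eq_intros simp: fun_eq_iff inner_commute algebra_simps)

lemma nonincreasing_from:
  fixes f :: "real \<Rightarrow> real"
  assumes T: "0 \<le> T" "T \<le> s"
    and d: "\<And>t. t \<ge> T \<Longrightarrow> (f has_real_derivative f' t) (at t within {0..})"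
    and "\<And>t. t \<ge> T \<Longrightarrow> f' t \<le> 0"
  shows "f s \<le> f T"
proof (rule DERIV_nonpos_imp_decreasing_open[OF \<open>T \<le> s\<close>])
  fix t assume "T < t"
  then show "\<exists>y. DERIV f t :> y \<and> y \<le> 0"
    using has_real_derivative_at_if_pos[OF d] assms by (intro exI[of _ "f' t"]) auto
next
  have "continuous_on {T..} f"
    using d T by (auto simp: continuous_on_eq_continuous_within intro: DERIV_continuous DERIV_subset)
  then show "continuous_on {T..s} f" by (rule continuous_on_subset) auto
qed

lemma gronwall_exp:
  fixes f :: "real \<Rightarrow> real"
  assumes T: "0 \<le> T" and ab: "0 \<le> b" "b < a" and C: "0 \<le> C"
    and d: "\<And>t. t \<ge> T \<Longrightarrow> (f has_real_derivative f' t) (at t within {0..})"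
    and le: "\<And>t. t \<ge> T \<Longrightarrow> f' t \<le> - a * f t + C * exp (- b * t)"
    and t: "t \<ge> T"
  shows "f t \<le> (exp (a * T) * \<bar>f T\<bar> + C / (a - b)) * exp (- b * t)"
proof -
  define g where "g = (\<lambda>t. exp (a * t) * f t - C / (a - b) * exp ((a - b) * t))"
  have "g t \<le> g T"
  proof (rule nonincreasing_from[OF T t])
    fix s assume s: "s \<ge> T"
    show "(g has_real_derivative exp (a * s) * (f' s + a * f s - C * exp (- b * s))) (at s within {0..})"
      unfolding g_def using ab
      by (auto intro!: derivative_eq_intros d[OF s])
         (auto simp: field_simps simp flip: exp_add)
    show "exp (a * s) * (f' s + a * f s - C * exp (- b * s)) \<le> 0"
      using le[OF s] by (intro mult_nonneg_nonpos) auto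
  qed
  also have "g T \<le> exp (a * T) * \<bar>f T\<bar>"
  proof -
    have "exp (a * T) * f T \<le> exp (a * T) * \<bar>f T\<bar>" by (intro mult_left_mono) auto
    moreover have "0 \<le> C / (a - b) * exp ((a - b) * T)" using C ab by simp
    ultimately show ?thesis unfolding g_def by linarith
  qed
  finally have "exp (a * t) * f t \<le> exp (a * T) * \<bar>f T\<bar> + C / (a - b) * exp ((a - b) * t)"
    unfolding g_def by linarith
  then have "exp (- a * t) * (exp (a * t) * f t) \<le>
      exp (- a * t) * (exp (a * T) * \<bar>f T\<bar> + C / (a - b) * exp ((a - b) * t))"
    by (intro mult_left_mono) auto
  moreover have "exp (- a * t) * (exp (a * t) * f t) = f t"
    by (simp add: exp_minus)
  moreover have "exp (- a * t) * exp ((a - b) * t) = exp (- b * t)"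
    by (simp add: algebra_simps flip: exp_add)
  ultimately have "f t \<le> exp (- a * t) * (exp (a * T) * \<bar>f T\<bar>) + C / (a - b) * exp (- b * t)"
    by (simp only: distrib_left mult.left_commute)
  \<comment> \<open>Since b < a and t \<ge> 0, the homogeneous part also decays at least at the
    slower rate b.\<close>
  also have "\<dots> \<le> exp (- b * t) * (exp (a * T) * \<bar>f T\<bar>) + C / (a - b) * exp (- b * t)"
    using T t ab by (intro add_right_mono mult_right_mono) (auto intro: mult_right_mono)
  finally show ?thesis by (simp add: algebra_simps)
qed

lemma exp_decay_gronwall:
  fixes f :: "real \<Rightarrow> real"
  assumes cont: "continuous_on {0..} f" and T: "0 \<le> T" and a: "a > 0" and h: "exp_decay h"
    and pos: "\<And>t. t \<ge> T \<Longrightarrow> 0 \<le> f t"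
    and d: "\<And>t. t \<ge> T \<Longrightarrow> (f has_real_derivative f' t) (at t within {0..})"
    and le: "\<And>t. t \<ge> T \<Longrightarrow> f' t \<le> - a * f t + h t"
  shows "exp_decay f"
proof -
  obtain C r where *: "C > 0" "r > 0" "\<And>t. t \<ge> 0 \<Longrightarrow> norm (h t) \<le> C * exp (- r * t)"
    using exp_decayE[OF h] by blast
  \<comment> \<open>The common rate is at most \<open>r\<close>, to dominate the forcing, and at
    most \<open>a/2\<close>, to stay strictly below \<open>a\<close> and avoid the resonant
    case.\<close>
  define b where "b = min r (a/2)"
  have b: "0 < b" "b < a" using a * by (auto simp: b_def)
  have "f t \<le> (exp (a * T) * \<bar>f T\<bar> + C / (a - b)) * exp (- b * t)" if "t \<ge> T" for t
  proof (rule gronwall_exp[OF T _ _ _ d _ that])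
    fix s assume s: "s \<ge> T"
    have "C * exp (- r * s) \<le> C * exp (- b * s)"
      using * s T by (intro mult_left_mono) (auto simp: b_def intro!: mult_right_mono)
    then show "f' s \<le> - a * f s + C * exp (- b * s)"
      using *(3)[of s] le[OF s] s T by auto
  qed (use b * in auto)
  then show ?thesis
    using pos b by (intro exp_decay_from[OF cont T \<open>0 < b\<close>]) auto
qed

text \<open>Integrating the bound on the derivative gives increments of size at most C/r exp(-r s)
  beyond time s. This tail estimate provides both the Cauchy property and the rate of
  convergence.\<close>

lemma exp_decay_derivative_imp_limit:
  fixes f :: "real \<Rightarrow> 'a::banach"
  assumes d: "\<And>t. t \<ge> 0 \<Longrightarrow> (f has_vector_derivative f' t) (at t within {0..})"
    and f': "exp_decay f'"
  obtains l where "exp_decay (\<lambda>t. f t - l)"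
proof -
  obtain C r where *: "C > 0" "r > 0" "\<And>t. t \<ge> 0 \<Longrightarrow> norm (f' t) \<le> C * exp (- r * t)"
    using exp_decayE[OF f'] by blast
  have cont: "continuous_on {0..} f"
    using d by (auto simp: continuous_on_eq_continuous_within intro: has_vector_derivative_continuous)
  have inc: "norm (f t - f s) \<le> C / r * exp (- r * s)" if "0 \<le> s" "s \<le> t" for s t
  proof (cases "s = t")
    case False
    \<comment> \<open>The comparison function -C/r exp(-r t) is an antiderivative of the bound on
      \<open>f'\<close>.\<close>
    have "norm (f t - f s) \<le> (- C / r * exp (- r * t)) - (- C / r * exp (- r * s))"
    proof (rule differentiable_bound_general)
      show "s < t" using that False by auto
      show "continuous_on {s..t} f" by (rule continuous_on_subset[OF cont]) (use that in auto)
      show "continuous_on {s..t} (\<lambda>t. - C / r * exp (- r * t))" by (intro continuous_intros)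
      fix y assume y: "s < y" "y < t"
      then have "at y within {0..} = at y"
        using that by (intro at_within_interior) (simp add: interior_real_atLeast)
      then show "(f has_vector_derivative f' y) (at y)"
        using d[of y] that y by simp
      show "((\<lambda>t. - C / r * exp (- r * t)) has_vector_derivative C * exp (- r * y)) (at y)"
        unfolding has_real_derivative_iff_has_vector_derivative[symmetric]
        using * by (auto intro!: derivative_eq_intros simp: field_simps)
      show "norm (f' y) \<le> C * exp (- r * y)" using *(3) y that by auto
    qed
    also have "\<dots> \<le> C / r * exp (- r * s)" using * by auto
    finally show ?thesis .
  qed (use * in auto)
  have e0: "((\<lambda>s. C / r * exp (- r * s)) \<longlongrightarrow> 0) at_top"
    using * by (intro exp_decay_tendsto_0 exp_decayI[of r _ "C / r"]) auto
  have "Cauchy (\<lambda>n. f (real n))"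
  proof (rule CauchyI)
    fix e :: real assume e: "0 < e"
    then have "\<forall>\<^sub>F s in at_top. C / r * exp (- r * s) < e / 2"
      using e0 by (intro order_tendstoD) auto
    then obtain S where S: "\<And>s. s \<ge> S \<Longrightarrow> C / r * exp (- r * s) < e / 2"
      by (auto simp: eventually_at_top_linorder)
    define K where "K = nat \<lceil>max S 0\<rceil>"
    have K: "real K \<ge> S" unfolding K_def by linarith
    have "norm (f (real n) - f (real K)) < e / 2" if "n \<ge> K" for n
      using inc[of "real K" "real n"] S[OF K] that by (meson of_nat_0_le_iff of_nat_mono order_le_less_trans)
    then show "\<exists>M. \<forall>m\<ge>M. \<forall>n\<ge>M. norm (f (real m) - f (real n)) < e"
      by (metis norm_diff_triangle_less norm_minus_commute field_sum_of_halves)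
  qed
  then obtain l where l: "(\<lambda>n. f (real n)) \<longlonglongrightarrow> l"
    using Cauchy_convergent convergent_def by blast
  \<comment> \<open>Keep s fixed in the increment bound and let the second time run to infinity
    along the integers.\<close>
  have "norm (f s - l) \<le> C / r * exp (- r * s)" if s: "s \<ge> 0" for s
  proof (rule tendsto_upperbound)
    show "(\<lambda>n. norm (f s - f (real n))) \<longlonglongrightarrow> norm (f s - l)"
      by (intro tendsto_intros l)
    have "norm (f s - f (real n)) \<le> C / r * exp (- r * s)" if "n \<ge> nat \<lceil>s\<rceil>" for n
      using inc[of s "real n"] s that by (simp add: norm_minus_commute nat_le_iff ceiling_le_iff)
    then show "\<forall>\<^sub>F n in sequentially. norm (f s - f (real n)) \<le> C / r * exp (- r * s)"
      unfolding eventually_sequentially by blast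
  qed auto
  then have "exp_decay (\<lambda>t. f t - l)" using * by (intro exp_decayI[of r _ "C / r"]) auto
  then show thesis by (rule that)
qed

text \<open>If \<open>f\<close> fell below \<open>c\<close>, then at the last time with value at
  least \<open>c\<close> it would equal \<open>c\<close>, and the positive derivative there would
  push it above \<open>c\<close> immediately afterwards.\<close>

lemma barrier_from_below:
  fixes f :: "real \<Rightarrow> real"
  assumes T: "0 \<le> T" "c \<le> f T"
    and d: "\<And>t. t \<ge> T \<Longrightarrow> (f has_real_derivative f' t) (at t within {0..})"
    and pos: "\<And>t. t \<ge> T \<Longrightarrow> f t = c \<Longrightarrow> f' t > 0"
    and t: "t \<ge> T"
  shows "c \<le> f t"
proof (rule ccontr)
  assume "\<not> c \<le> f t"
  then have ft: "f t < c" by simp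
  have cont: "continuous_on {T..} f"
    using d T by (auto simp: continuous_on_eq_continuous_within intro: DERIV_continuous DERIV_subset)
  \<comment> \<open>\<open>A\<close> collects the times up to \<open>t\<close> above the barrier.
    Continuity makes it closed, so its supremum is attained: the last such time.\<close>
  define A where "A = {s \<in> {T..t}. c \<le> f s}"
  have "A = {T..t} \<inter> f -` {c..}" by (auto simp: A_def)
  moreover have "closed ({T..t} \<inter> f -` {c..})"
    by (intro continuous_closed_preimage continuous_on_subset[OF cont]) auto
  ultimately have "closed A" by simp
  have bdd: "bdd_above A" by (auto simp: A_def)
  have "T \<in> A" using T t by (auto simp: A_def)
  define s where "s = Sup A"
  have sA: "s \<in> A" unfolding s_def
    using closed_contains_Sup[OF _ bdd \<open>closed A\<close>] \<open>T \<in> A\<close> by blast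
  have after: "f y < c" if "s < y" "y \<le> t" for y
    using cSup_upper[OF _ bdd, of y] that sA by (fastforce simp: A_def s_def)
  have "s < t" using sA ft by (auto simp: A_def order.order_iff_strict)
  have s: "s \<ge> T" "c \<le> f s" using sA by (auto simp: A_def)
  have "f s \<le> c"
  proof (rule tendsto_upperbound)
    have "(f \<longlongrightarrow> f s) (at s within {T..})" using cont s by (auto simp: continuous_on_def)
    then show "(f \<longlongrightarrow> f s) (at s within {s<..t})" by (rule tendsto_within_subset) (use s in auto)
    show "\<forall>\<^sub>F y in at s within {s<..t}. f y \<le> c"
      using after by (auto simp: eventually_at_filter intro!: always_eventually less_imp_le)
    show "at s within {s<..t} \<noteq> bot"
      using \<open>s < t\<close> by (simp add: at_within_eq_bot_iff)
  qed
  then have fs: "f s = c" using s by simp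
  from has_real_derivative_pos_inc_right[OF d[OF s(1)] pos[OF s(1) fs]]
  obtain e where e: "e > 0" "\<And>h. 0 < h \<Longrightarrow> s + h \<in> {0..} \<Longrightarrow> h < e \<Longrightarrow> f s < f (s + h)" by blast
  define h where "h = min (e/2) (t - s)"
  have "0 < h" "h < e" "s + h \<le> t" using e \<open>s < t\<close> by (auto simp: h_def)
  then have "f s < f (s + h)" "f (s + h) < c" using e(2)[of h] after[of "s + h"] s T by auto
  then show False using fs by simp
qed

section \<open>The field $|a|^p a$\<close>

text \<open>The inner product splits into a radial part, nonnegative because s^p s is increasing in
  s \<ge> 0, and an angular part, nonnegative by Cauchy-Schwarz.\<close>

lemma powr_field_monotone:
  fixes a b :: "'a::real_inner"
  assumes "p > 0"
  shows "0 \<le> inner (a - b) ((norm a powr p) *\<^sub>R a - (norm b powr p) *\<^sub>R b)"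
proof -
  have 1: "0 \<le> (norm a powr p + norm b powr p) * (norm a * norm b - inner a b)"
    by (intro mult_nonneg_nonneg) (auto simp: norm_cauchy_schwarz)
  have 2: "0 \<le> (norm a - norm b) * (norm a powr p * norm a - norm b powr p * norm b)"
  proof (cases "norm a \<le> norm b")
    case True
    then have "norm a powr p * norm a \<le> norm b powr p * norm b"
      using assms by (intro mult_mono powr_mono2) auto
    then show ?thesis using True by (intro mult_nonpos_nonpos) auto
  next
    case False
    then have "norm b powr p * norm b \<le> norm a powr p * norm a"
      using assms by (intro mult_mono powr_mono2) auto
    then show ?thesis using False by (intro mult_nonneg_nonneg) auto
  qed
  have "inner (a - b) ((norm a powr p) *\<^sub>R a - (norm b powr p) *\<^sub>R b)
      = norm a powr p * (norm a)\<^sup>2 + norm b powr p * (norm b)\<^sup>2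
        - (norm a powr p + norm b powr p) * inner a b"
    by (simp add: inner_diff_left inner_diff_right inner_commute power2_norm_eq_inner algebra_simps)
  also have "\<dots> = (norm a - norm b) * (norm a powr p * norm a - norm b powr p * norm b)
      + (norm a powr p + norm b powr p) * (norm a * norm b - inner a b)"
    by (simp add: algebra_simps power2_eq_square)
  finally show ?thesis using 1 2 by linarith
qed

text \<open>The factor \<open>s\<close> compensates the singularity of z^(p-1) at the origin when p
  < 1, so the estimate is uniform down to zero for every p > 0.\<close>

lemma powr_diff_le:
  fixes p :: real
  assumes p: "p > 0" and "0 \<le> s" "s \<le> t" "t \<le> B"
  shows "(t powr p - s powr p) * s \<le> p * B powr p * (t - s)"
proof (cases "s = 0 \<or> s = t")
  case False
  then have "0 < s" "s < t" using assms by auto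
  obtain z where z: "s < z" "z < t" "t powr p - s powr p = (t - s) * (p * z powr (p - 1))"
    using MVT2[OF \<open>s < t\<close>, of "\<lambda>z. z powr p" "\<lambda>z. p * z powr (p - 1)"] has_real_derivative_powr \<open>0 < s\<close>
    by (metis less_le_trans)
  \<comment> \<open>Replacing \<open>s\<close> by the larger mean-value point \<open>z\<close> turns
    z^(p-1) into z^p, which is at most B^p.\<close>
  have "(t powr p - s powr p) * s \<le> (t powr p - s powr p) * z"
    using z assms by (intro mult_left_mono) (auto intro: powr_mono2)
  also have "\<dots> = p * z powr p * (t - s)"
    using z \<open>0 < s\<close> by (simp add: powr_diff)
  also have "\<dots> \<le> p * B powr p * (t - s)"
    using z \<open>0 < s\<close> assms by (intro mult_right_mono mult_left_mono powr_mono2) auto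
  finally show ?thesis .
qed (use assms in auto)

lemma powr_field_lipschitz:
  fixes a b :: "'a::real_normed_vector"
  assumes p: "p > 0" and "norm a \<le> B" "norm b \<le> B"
  shows "norm ((norm a powr p) *\<^sub>R a - (norm b powr p) *\<^sub>R b) \<le> (p + 1) * B powr p * norm (a - b)"
proof -
  have *: "norm ((norm a powr p) *\<^sub>R a - (norm b powr p) *\<^sub>R b) \<le> (p + 1) * B powr p * norm (a - b)"
    if le: "norm a \<le> norm b" and b: "norm b \<le> B" for a b :: 'a
  proof -
    \<comment> \<open>The difference of the powers is multiplied by the shorter vector
      \<open>a\<close>, which is exactly the product that \<open>powr_diff_le\<close>
      controls.\<close>
    have "(norm a powr p) *\<^sub>R a - (norm b powr p) *\<^sub>R b
        = (norm b powr p) *\<^sub>R (a - b) - (norm b powr p - norm a powr p) *\<^sub>R a"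
      by (simp add: algebra_simps)
    then have "norm ((norm a powr p) *\<^sub>R a - (norm b powr p) *\<^sub>R b)
        \<le> norm b powr p * norm (a - b) + \<bar>norm b powr p - norm a powr p\<bar> * norm a"
      using norm_triangle_ineq4[of "(norm b powr p) *\<^sub>R (a - b)" "(norm b powr p - norm a powr p) *\<^sub>R a"]
      by simp
    also have "\<bar>norm b powr p - norm a powr p\<bar> = norm b powr p - norm a powr p"
      using le p by (intro abs_of_nonneg) (auto intro: powr_mono2)
    also have "(norm b powr p - norm a powr p) * norm a \<le> p * B powr p * (norm b - norm a)"
      using powr_diff_le[OF p _ le b] by simp
    also have "\<dots> \<le> p * B powr p * norm (a - b)"
      using p norm_triangle_ineq3[of a b] by (intro mult_left_mono) auto
    also have "norm b powr p * norm (a - b) \<le> B powr p * norm (a - b)"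
      using b p by (intro mult_right_mono powr_mono2) auto
    finally show ?thesis by (simp add: algebra_simps)
  qed
  show ?thesis
  proof (cases "norm a \<le> norm b")
    case False
    then show ?thesis using *[of b a] assms by (simp add: norm_minus_commute)
  qed (use * assms in auto)
qed

section \<open>Exponentially small perturbations of the Rayleigh flow\<close>

lemma rayleigh_dichotomy:
  fixes u R :: "real \<Rightarrow> 'a::{real_inner, banach}"
  assumes \<sigma>: "\<sigma> > 0" and p: "p > 0" and \<theta>: "\<theta> > 0"
    and d: "\<And>t. t \<ge> 0 \<Longrightarrow>
      (u has_vector_derivative (\<sigma> * (\<theta> - norm (u t) powr p)) *\<^sub>R u t + R t) (at t within {0..})"
    and R: "exp_decay R" and B: "\<And>t. t \<ge> 0 \<Longrightarrow> norm (u t) \<le> B"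
    and not0: "\<not> (u \<longlongrightarrow> 0) at_top"
  obtains l where "norm l = \<theta> powr (1/p)" "exp_decay (\<lambda>t. u t - l)"
proof -
  let ?u' = "\<lambda>t. (\<sigma> * (\<theta> - norm (u t) powr p)) *\<^sub>R u t + R t"
  have cont: "continuous_on {0..} u"
    using d by (auto simp: continuous_on_eq_continuous_within intro: has_vector_derivative_continuous)
  have dr: "((\<lambda>t. inner (u t) (u t)) has_real_derivative 2 * inner (u t) (?u' t)) (at t within {0..})"
    if "t \<ge> 0" for t
    using has_real_derivative_norm_power2[OF d[OF that]] by (simp only: power2_norm_eq_inner)
  obtain \<epsilon> where \<epsilon>: "\<epsilon> > 0" "\<not> (\<forall>\<^sub>F t in at_top. dist (u t) 0 < \<epsilon>)"
    using not0 unfolding tendsto_iff by blast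
  \<comment> \<open>Being at most \<open>\<epsilon>\<close>, the radius \<open>\<delta>\<close> is
    exceeded at arbitrarily late times; lying strictly below the equilibrium radius
    \<open>\<theta> powr (1/p)\<close>, it is one at which the unperturbed drift points
    outward.\<close>
  define \<delta> where "\<delta> = min \<epsilon> (\<theta> powr (1/p) / 2)"
  have \<delta>: "\<delta> > 0" "\<delta> \<le> \<epsilon>" using \<epsilon> \<theta> by (auto simp: \<delta>_def)
  have "\<theta> powr (1/p) > 0" using \<theta> by simp
  then have "\<delta> < \<theta> powr (1/p)" unfolding \<delta>_def by linarith
  then have "\<delta> powr p < (\<theta> powr (1/p)) powr p" using \<delta> p by (intro powr_less_mono2) auto
  then have \<delta>p: "\<delta> powr p < \<theta>" using p \<theta> by (simp add: powr_powr)
  \<comment> \<open>At |u| = \<delta> the drift contributes \<delta> \<eta> to inner(u, u'), while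
    \<open>R\<close> can subtract at most \<delta> |R|. Once |R| < \<eta> the sphere of radius
    \<delta> cannot be crossed inward.\<close>
  define \<eta> where "\<eta> = \<sigma> * (\<theta> - \<delta> powr p) * \<delta>"
  have "\<eta> > 0" using \<delta>p \<sigma> \<delta> by (simp add: \<eta>_def)
  then have "\<forall>\<^sub>F t in at_top. norm (R t) < \<eta>"
    using exp_decay_tendsto_0[OF R] by (auto simp: tendsto_iff)
  then obtain S where S: "\<And>t. t \<ge> S \<Longrightarrow> norm (R t) < \<eta>"
    by (auto simp: eventually_at_top_linorder)
  obtain T where T: "T \<ge> max S 0" "\<not> norm (u T) < \<epsilon>"
    using \<epsilon>(2) unfolding eventually_at_top_linorder dist_0_norm dist_norm diff_0_right by blast
  have T0: "0 \<le> T" "S \<le> T" using T by auto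
  have lower: "\<delta> \<le> norm (u t)" if t: "t \<ge> T" for t
  proof -
    have "\<delta>\<^sup>2 \<le> inner (u t) (u t)"
    proof (rule barrier_from_below[OF T0(1) _ _ _ t])
      show "\<delta>\<^sup>2 \<le> inner (u T) (u T)"
        using T \<delta> by (auto simp flip: power2_norm_eq_inner intro!: power_mono)
      show "((\<lambda>t. inner (u t) (u t)) has_real_derivative 2 * inner (u t) (?u' t)) (at t within {0..})"
        if "t \<ge> T" for t
        using dr that T0 by simp
      fix t assume t: "t \<ge> T" "inner (u t) (u t) = \<delta>\<^sup>2"
      then have nu: "norm (u t) = \<delta>" using \<delta> by (simp add: norm_eq_sqrt_inner)
      have "- inner (u t) (R t) \<le> \<delta> * norm (R t)"
        using Cauchy_Schwarz_ineq2[of "u t" "R t"] nu by simp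
      also have "\<dots> < \<delta> * \<eta>" using \<delta> S[of t] t T0 by (intro mult_strict_left_mono) auto
      also have "\<delta> * \<eta> = \<sigma> * (\<theta> - \<delta> powr p) * inner (u t) (u t)"
        unfolding t \<eta>_def by (simp add: power2_eq_square)
      finally show "0 < 2 * inner (u t) (?u' t)"
        using nu by (simp add: inner_add_right)
    qed
    then have "\<delta>\<^sup>2 \<le> (norm (u t))\<^sup>2" by (simp add: power2_norm_eq_inner)
    then show ?thesis by (rule power2_le_imp_le) simp
  qed
  define y where "y = (\<lambda>t. norm (u t) powr p)"
  have y_bound: "y t \<le> B powr p" if "t \<ge> 0" for t
    using B[OF that] p by (auto simp: y_def intro: powr_mono2)
  \<comment> \<open>This is the contribution of \<open>R\<close> to the derivative of |u|^p.\<close>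
  define e where "e = (\<lambda>t. p * norm (u t) powr (p - 2) * inner (u t) (R t))"
  have dy: "(y has_real_derivative p * \<sigma> * (\<theta> - y t) * y t + e t) (at t within {0..})" if "t \<ge> T" for t
  proof -
    have pos: "norm (u t) > 0" using lower[OF that] \<delta> by linarith
    \<comment> \<open>Writing |u|^p as a power of inner(u, u) allows the chain rule; the base is
      positive after \<open>T\<close> by the lower bound.\<close>
    have eq: "y = (\<lambda>t. inner (u t) (u t) powr (p/2))"
      unfolding y_def by (simp add: norm_eq_sqrt_inner powr_half_sqrt[symmetric] powr_powr)
    have pw: "inner (u t) (u t) powr (p/2 - 1) = norm (u t) powr (p - 2)"
    proof -
      have "inner (u t) (u t) = norm (u t) powr 2" using pos by (simp add: power2_norm_eq_inner)
      then show ?thesis by (simp only: powr_powr) (simp add: algebra_simps)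
    qed
    have "((\<lambda>t. inner (u t) (u t) powr (p/2)) has_real_derivative
        (p/2) * inner (u t) (u t) powr (p/2 - 1) * (2 * inner (u t) (?u' t))) (at t within {0..})"
      using pos that T0 by (intro DERIV_chain2[OF has_real_derivative_powr dr]) auto
    moreover have "(p/2) * inner (u t) (u t) powr (p/2 - 1) * (2 * inner (u t) (?u' t))
        = p * \<sigma> * (\<theta> - y t) * (norm (u t) powr (p - 2) * inner (u t) (u t)) + e t"
      unfolding pw e_def y_def by (simp add: inner_add_right algebra_simps)
    moreover have "norm (u t) powr (p - 2) * inner (u t) (u t) = y t"
      using pos by (simp add: y_def powr_diff power2_norm_eq_inner)
    ultimately show ?thesis using eq by simp
  qed
  have e: "\<bar>e t\<bar> \<le> p * (B powr p / \<delta>) * norm (R t)" if "t \<ge> T" for t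
  proof -
    have pos: "norm (u t) > 0" using lower[OF that] \<delta> by linarith
    have "\<bar>e t\<bar> \<le> p * norm (u t) powr (p - 2) * (norm (u t) * norm (R t))"
      unfolding e_def abs_mult using p Cauchy_Schwarz_ineq2[of "u t" "R t"]
      by (auto intro!: mult_left_mono)
    also have "\<dots> = p * (norm (u t) powr p / norm (u t)) * norm (R t)"
      using pos by (simp add: powr_diff field_simps power2_eq_square)
    also have "\<dots> \<le> p * (B powr p / \<delta>) * norm (R t)"
      using p that T0 lower[OF that] \<delta> B[of t]
      by (intro mult_right_mono mult_left_mono frac_le powr_mono2) auto
    finally show ?thesis .
  qed
  \<comment> \<open>Before \<open>T\<close> the vector \<open>u\<close> may vanish; p > 0 keeps
    |u|^p continuous there.\<close>
  have y_cont: "continuous_on {0..} y"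
    unfolding y_def using p by (intro continuous_on_powr' continuous_intros cont) auto
  \<comment> \<open>The square supplies the nonnegative quantity required by
    \<open>exp_decay_gronwall\<close>. The bound y \<ge> \<delta>^p turns the logistic term into
    linear damping, and the mixed term with \<open>e\<close> is bounded by a multiple of
    |R|.\<close>
  have "exp_decay (\<lambda>t. (y t - \<theta>)\<^sup>2)"
  proof (rule exp_decay_gronwall[OF _ T0(1)])
    show "continuous_on {0..} (\<lambda>t. (y t - \<theta>)\<^sup>2)" by (intro continuous_intros y_cont)
    show "0 < 2 * p * \<sigma> * \<delta> powr p" using p \<sigma> \<delta> by simp
    let ?K = "2 * (B powr p + \<theta>) * (p * (B powr p / \<delta>))"
    have "exp_decay (\<lambda>t. norm (R t))" using R by (simp add: exp_decay_def)
    then have "exp_decay (\<lambda>t. ?K *\<^sub>R norm (R t))" by (rule exp_decay_scaleR_left) (rule order_refl)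
    then show "exp_decay (\<lambda>t. ?K * norm (R t))" by simp
    fix t assume t: "t \<ge> T"
    show "((\<lambda>t. (y t - \<theta>)\<^sup>2) has_real_derivative
        2 * (y t - \<theta>) * (p * \<sigma> * (\<theta> - y t) * y t + e t)) (at t within {0..})"
      by (auto intro!: derivative_eq_intros dy[OF t])
    have "2 * (y t - \<theta>) * (p * \<sigma> * (\<theta> - y t) * y t + e t)
        = - (2 * p * \<sigma> * y t) * (y t - \<theta>)\<^sup>2 + 2 * ((y t - \<theta>) * e t)"
      by (simp add: algebra_simps power2_eq_square)
    also have "- (2 * p * \<sigma> * y t) * (y t - \<theta>)\<^sup>2 \<le> - (2 * p * \<sigma> * \<delta> powr p) * (y t - \<theta>)\<^sup>2"
      using p \<sigma> lower[OF t] \<delta>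
      by (intro mult_right_mono) (auto simp: y_def intro!: mult_left_mono powr_mono2)
    also have "(y t - \<theta>) * e t \<le> (B powr p + \<theta>) * (p * (B powr p / \<delta>) * norm (R t))"
    proof -
      have "(y t - \<theta>) * e t \<le> \<bar>y t - \<theta>\<bar> * \<bar>e t\<bar>" by (simp flip: abs_mult)
      also have "\<dots> \<le> (B powr p + \<theta>) * (p * (B powr p / \<delta>) * norm (R t))"
      proof (intro mult_mono e[OF t])
        have "0 \<le> y t" by (simp add: y_def)
        then show "\<bar>y t - \<theta>\<bar> \<le> B powr p + \<theta>" using y_bound[of t] t T0 \<theta> by (auto simp: abs_if)
      qed (use \<theta> in auto)
      finally show ?thesis .
    qed
    finally show "2 * (y t - \<theta>) * (p * \<sigma> * (\<theta> - y t) * y t + e t)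
        \<le> - (2 * p * \<sigma> * \<delta> powr p) * (y t - \<theta>)\<^sup>2 + ?K * norm (R t)"
      by (simp only: mult.assoc)
  qed auto
  from exp_decay_sqrt[OF this] have y_lim: "exp_decay (\<lambda>t. y t - \<theta>)"
    by (simp add: exp_decay_def)
  have "exp_decay (\<lambda>t. (\<sigma> * (\<theta> - norm (u t) powr p)) *\<^sub>R u t)"
    using y_lim
  proof (rule exp_decay_dominated[where K = "\<sigma> * B"])
    fix t :: real assume "t \<ge> 0"
    then show "norm ((\<sigma> * (\<theta> - norm (u t) powr p)) *\<^sub>R u t) \<le> \<sigma> * B * norm (y t - \<theta>)"
      using B[of t] \<sigma> mult_left_mono[of "norm (u t)" B "\<bar>\<theta> - y t\<bar>"]
      by (simp add: y_def abs_mult abs_minus_commute mult_ac)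
  qed
  then have "exp_decay ?u'" using R by (rule exp_decay_add)
  then obtain l where l: "exp_decay (\<lambda>t. u t - l)"
    using exp_decay_derivative_imp_limit[OF d] by blast
  \<comment> \<open>The length of \<open>l\<close> is found by comparing two limits of |u|^p: |l|^p
    by continuity, and \<theta> by the logistic estimate.\<close>
  have "(u \<longlongrightarrow> l) at_top" using exp_decay_tendsto_0[OF l] by (simp add: LIM_zero_iff)
  then have "(y \<longlongrightarrow> norm l powr p) at_top"
    unfolding y_def using p by (intro tendsto_powr' tendsto_intros) auto
  moreover have "(y \<longlongrightarrow> \<theta>) at_top" using exp_decay_tendsto_0[OF y_lim] by (simp add: LIM_zero_iff)
  ultimately have "norm l powr p = \<theta>" by (rule tendsto_unique[rotated]) simp
  then have "norm l = \<theta> powr (1/p)" using p by (auto simp: powr_powr)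
  then show thesis using l that by blast
qed

section \<open>Weighted averages and dissipation\<close>

locale weights =
  fixes N :: nat and m :: "nat \<Rightarrow> real"
  assumes N: "N \<ge> 1" and m_pos: "i < N \<Longrightarrow> m i > 0"
begin

definition mass :: real where "mass = (\<Sum>i<N. m i)"

text \<open>Values in any real inner product space are allowed, so the same results serve the
  scalars \<theta> and the velocities.\<close>

definition wmean :: "(nat \<Rightarrow> 'a::real_inner) \<Rightarrow> 'a" where
  "wmean z = (1 / mass) *\<^sub>R (\<Sum>i<N. m i *\<^sub>R z i)"

definition wvar :: "(nat \<Rightarrow> 'a::real_inner) \<Rightarrow> real" where
  "wvar z = (\<Sum>i<N. m i * (norm (z i - wmean z))\<^sup>2)"

lemma mass_pos: "mass > 0"
  unfolding mass_def using N m_pos by (intro sum_pos) (auto simp: lessThan_empty_iff)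

lemma sum_weights: "(\<Sum>i<N. m i *\<^sub>R z i) = mass *\<^sub>R wmean z"
  using mass_pos by (simp add: wmean_def)

lemma wmean_const: "wmean (\<lambda>i. c) = c"
  using mass_pos by (simp add: wmean_def mass_def flip: scaleR_sum_left)

lemma wmean_add: "wmean (\<lambda>i. f i + g i) = wmean f + wmean g"
  by (simp add: wmean_def scaleR_add_right sum.distrib)

lemma wmean_diff: "wmean (\<lambda>i. f i - g i) = wmean f - wmean g"
  by (simp add: wmean_def scaleR_diff_right sum_subtractf)

lemma wmean_scaleR: "wmean (\<lambda>i. c *\<^sub>R f i) = c *\<^sub>R wmean f"
  by (simp add: wmean_def scaleR_sum_right mult_ac)

text \<open>Deviations from the weighted mean are orthogonal to constants. Hence a term independent
  of the index may be inserted into or dropped from such sums.\<close>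

lemma sum_deviation: "(\<Sum>i<N. m i * inner (z i - wmean z) y) = 0"
proof -
  have "(\<Sum>i<N. m i * inner (z i - wmean z) y) = inner (\<Sum>i<N. m i *\<^sub>R (z i - wmean z)) y"
    by (simp add: inner_sum_left)
  also have "(\<Sum>i<N. m i *\<^sub>R (z i - wmean z)) = 0"
    by (simp only: sum_weights wmean_diff wmean_const) simp
  finally show ?thesis by simp
qed

lemma wvar_nonneg: "0 \<le> wvar z"
  unfolding wvar_def using m_pos by (intro sum_nonneg) (auto simp: less_imp_le)

lemma wvar_eq: "wvar z = (\<Sum>i<N. m i * inner (z i - wmean z) (z i))"
proof -
  have "wvar z = (\<Sum>i<N. m i * inner (z i - wmean z) (z i)) - (\<Sum>i<N. m i * inner (z i - wmean z) (wmean z))"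
    unfolding wvar_def power2_norm_eq_inner sum_subtractf[symmetric]
    by (intro sum.cong) (auto simp: inner_diff_right algebra_simps)
  then show ?thesis by (simp add: sum_deviation)
qed

lemma norm_deviation_le:
  assumes "i < N"
  shows "norm (z i - wmean z) \<le> sqrt (1 / m i) * sqrt (wvar z)"
proof -
  have "m i * (norm (z i - wmean z))\<^sup>2 \<le> wvar z"
    unfolding wvar_def using assms m_pos
    by (intro member_le_sum[of i _ "\<lambda>i. m i * (norm (z i - wmean z))\<^sup>2"]) (auto simp: less_imp_le)
  then have "(norm (z i - wmean z))\<^sup>2 \<le> 1 / m i * wvar z"
    using m_pos[OF assms] by (simp add: field_simps)
  then have "sqrt ((norm (z i - wmean z))\<^sup>2) \<le> sqrt (1 / m i * wvar z)"
    by (rule real_sqrt_le_mono)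
  then show ?thesis by (simp only: real_sqrt_mult real_sqrt_abs abs_norm_cancel)
qed

lemma norm_wmean_le:
  assumes "\<And>i. i < N \<Longrightarrow> norm (z i) \<le> B"
  shows "norm (wmean z) \<le> B"
proof -
  have "norm (\<Sum>i<N. m i *\<^sub>R z i) \<le> (\<Sum>i<N. m i * B)"
    using assms m_pos by (intro sum_norm_le) (auto simp: less_imp_le)
  also have "\<dots> = mass * B" by (simp add: mass_def sum_distrib_right)
  finally show ?thesis using mass_pos by (simp add: wmean_def field_simps)
qed

section \<open>Symmetric exchange: dissipation and conservation\<close>

text \<open>Add the sum to its copy with \<open>i\<close> and \<open>j\<close> exchanged: the common
  shift \<open>y\<close> cancels and each pair contributes minus a squared distance. The choice y =
  0 serves the energy, y = mean the variance.\<close>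

lemma symmetric_exchange:
  assumes sym: "\<And>i j. w i j = w j i"
  shows "(\<Sum>i<N. m i * inner (z i - y) (\<Sum>j<N. (m j * w i j) *\<^sub>R (z j - z i)))
    = - (1/2) * (\<Sum>i<N. \<Sum>j<N. m i * m j * w i j * (norm (z i - z j))\<^sup>2)" (is "?S = _")
proof -
  have S: "?S = (\<Sum>i<N. \<Sum>j<N. m i * m j * w i j * inner (z i - y) (z j - z i))"
    by (simp add: inner_sum_right sum_distrib_left mult_ac)
  also have "\<dots> = (\<Sum>j<N. \<Sum>i<N. m i * m j * w i j * inner (z i - y) (z j - z i))"
    by (rule sum.swap)
  also have "\<dots> = (\<Sum>i<N. \<Sum>j<N. m i * m j * w i j * inner (z j - y) (z i - z j))"
    by (intro sum.cong refl) (subst sym, simp add: mult_ac)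
  finally have "?S + ?S = (\<Sum>i<N. \<Sum>j<N. m i * m j * w i j * inner (z i - y) (z j - z i)
      + m i * m j * w i j * inner (z j - y) (z i - z j))"
    using S by (simp add: sum.distrib)
  also have "\<dots> = (\<Sum>i<N. \<Sum>j<N. - (m i * m j * w i j * (norm (z i - z j))\<^sup>2))"
    by (intro sum.cong refl)
       (simp add: power2_norm_eq_inner inner_diff_left inner_diff_right inner_commute algebra_simps)
  finally show ?thesis by (simp add: sum_negf)
qed

text \<open>This is the exchange identity for the constant weight 1, where the inner sum reduces to
  minus the mass times the deviation.\<close>

lemma sum_norm_differences: "(\<Sum>i<N. \<Sum>j<N. m i * m j * (norm (z i - z j))\<^sup>2) = 2 * mass * wvar z"
proof -
  have "(\<Sum>j<N. m j *\<^sub>R (z j - z i)) = - mass *\<^sub>R (z i - wmean z)" for i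
    by (simp add: sum_weights wmean_diff wmean_const) (simp add: algebra_simps)
  then have "(\<Sum>i<N. m i * inner (z i - wmean z) (\<Sum>j<N. m j *\<^sub>R (z j - z i))) = - mass * wvar z"
    by (simp add: wvar_def power2_norm_eq_inner sum_distrib_left sum_negf mult_ac)
  then show ?thesis
    using symmetric_exchange[of "\<lambda>i j. 1" z "wmean z"] by simp
qed

lemma exchange_dissipation:
  assumes sym: "\<And>i j. w i j = w j i" and w: "\<And>i j. i < N \<Longrightarrow> j < N \<Longrightarrow> c \<le> w i j"
  shows "(\<Sum>i<N. m i * inner (z i - y) (\<Sum>j<N. (m j * w i j) *\<^sub>R (z j - z i))) \<le> - (c * mass * wvar z)"
proof -
  have "c * (2 * mass * wvar z) = (\<Sum>i<N. \<Sum>j<N. c * (m i * m j * (norm (z i - z j))\<^sup>2))"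
    by (simp add: sum_distrib_left flip: sum_norm_differences)
  also have "\<dots> \<le> (\<Sum>i<N. \<Sum>j<N. w i j * (m i * m j * (norm (z i - z j))\<^sup>2))"
    using w m_pos by (intro sum_mono mult_right_mono) (auto intro!: mult_nonneg_nonneg simp: less_imp_le)
  also have "\<dots> = (\<Sum>i<N. \<Sum>j<N. m i * m j * w i j * (norm (z i - z j))\<^sup>2)"
    by (simp add: mult_ac)
  finally show ?thesis
    unfolding symmetric_exchange[of w, OF sym] by simp
qed

text \<open>The double sum is antisymmetric under exchange of \<open>i\<close> and \<open>j\<close>,
  hence equal to its own negative.\<close>

lemma wmean_exchange:
  assumes sym: "\<And>i j. w i j = w j i"
  shows "wmean (\<lambda>i. \<Sum>j<N. (m j * w i j) *\<^sub>R (z j - z i)) = 0"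
proof -
  let ?S = "\<Sum>i<N. \<Sum>j<N. (m i * m j * w i j) *\<^sub>R (z j - z i)"
  have "?S = (\<Sum>j<N. \<Sum>i<N. (m i * m j * w i j) *\<^sub>R (z j - z i))" by (rule sum.swap)
  also have "\<dots> = (\<Sum>i<N. \<Sum>j<N. - ((m i * m j * w i j) *\<^sub>R (z j - z i)))"
    by (intro sum.cong refl) (subst sym, simp add: algebra_simps)
  also have "\<dots> = - ?S" by (simp add: sum_negf)
  finally have "?S = 0" by (simp add: eq_neg_iff_add_eq_0 flip: scaleR_2)
  then show ?thesis by (simp add: wmean_def scaleR_sum_right mult_ac)
qed

section \<open>Evolution of mean and variance\<close>

lemma wmean_has_vector_derivative:
  assumes "\<And>i. i < N \<Longrightarrow> (z i has_vector_derivative z' i) F"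
  shows "((\<lambda>t. wmean (\<lambda>i. z i t)) has_vector_derivative wmean z') F"
  unfolding wmean_def
  by (intro bounded_linear.has_vector_derivative[OF bounded_linear_scaleR_right]
      has_vector_derivative_sum assms) auto

text \<open>The motion of the mean itself drops out of the derivative, because deviations are
  orthogonal to constants.\<close>

lemma wvar_has_real_derivative:
  assumes "\<And>i. i < N \<Longrightarrow> (z i has_vector_derivative z' i) (at t within S)"
  shows "((\<lambda>t. wvar (\<lambda>i. z i t)) has_real_derivative
    2 * (\<Sum>i<N. m i * inner (z i t - wmean (\<lambda>i. z i t)) (z' i))) (at t within S)"
proof -
  have "((\<lambda>t. wvar (\<lambda>i. z i t)) has_real_derivative
    (\<Sum>i<N. m i * (2 * inner (z i t - wmean (\<lambda>i. z i t)) (z' i - wmean z')))) (at t within S)"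
    unfolding wvar_def
    by (intro DERIV_sum DERIV_cmult has_real_derivative_norm_power2 has_vector_derivative_diff
        wmean_has_vector_derivative assms) auto
  moreover have "(\<Sum>i<N. m i * (2 * inner (z i t - wmean (\<lambda>i. z i t)) (z' i - wmean z')))
      = 2 * (\<Sum>i<N. m i * inner (z i t - wmean (\<lambda>i. z i t)) (z' i))
        - 2 * (\<Sum>i<N. m i * inner (z i t - wmean (\<lambda>i. z i t)) (wmean z'))"
    unfolding sum_distrib_left sum_subtractf[symmetric]
    by (intro sum.cong) (auto simp: inner_diff_right[of _ "z' _"] algebra_simps)
  ultimately show ?thesis by (simp add: sum_deviation)
qed

lemma exp_decay_deviation:
  fixes z :: "nat \<Rightarrow> real \<Rightarrow> 'a::real_inner"
  assumes "exp_decay (\<lambda>t. wvar (\<lambda>i. z i t))" "i < N"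
  shows "exp_decay (\<lambda>t. z i t - wmean (\<lambda>i. z i t))"
  using exp_decay_sqrt[OF assms(1)]
proof (rule exp_decay_dominated)
  show "norm (z i t - wmean (\<lambda>i. z i t)) \<le> sqrt (1 / m i) * norm (sqrt (wvar (\<lambda>i. z i t)))" for t
    using norm_deviation_le[OF assms(2), of "\<lambda>i. z i t"] wvar_nonneg[of "\<lambda>i. z i t"] by simp
qed

lemma continuous_wvar:
  fixes z :: "nat \<Rightarrow> real \<Rightarrow> 'a::real_inner"
  assumes "\<And>i t. i < N \<Longrightarrow> t \<ge> 0 \<Longrightarrow> (z i has_vector_derivative z' i t) (at t within {0..})"
  shows "continuous_on {0..} (\<lambda>t. wvar (\<lambda>i. z i t))"
  unfolding continuous_on_eq_continuous_within
  using wvar_has_real_derivative[of z, OF assms] by (auto intro: DERIV_continuous)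

end

section \<open>The flocking system\<close>

text \<open>The constant \<open>c\<close> is any positive lower bound of the kernel; the final proof
  takes the infimum. The condition \<open>strong\<close> makes alignment outweigh the mean
  self-propulsion.\<close>

locale csf = weights N m for N m +
  fixes \<sigma> p \<kappa> c :: real and \<phi> :: "real \<Rightarrow> real"
    and x v :: "nat \<Rightarrow> real \<Rightarrow> real ^ 'n" and \<theta> :: "nat \<Rightarrow> real \<Rightarrow> real"
  assumes \<sigma>: "\<sigma> > 0" and p: "p > 0" and \<kappa>: "\<kappa> > 0"
    and c: "c > 0" and \<phi>: "\<And>r. r \<ge> 0 \<Longrightarrow> c \<le> \<phi> r"
    and \<theta>0: "\<And>i. i < N \<Longrightarrow> \<theta> i 0 > 0"
    and strong: "\<sigma> * wmean (\<lambda>i. \<theta> i 0) < c * mass"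
    and sol: "CSF_solution N m \<sigma> p \<kappa> \<phi> x v \<theta>"
begin

definition w :: "real \<Rightarrow> nat \<Rightarrow> nat \<Rightarrow> real" where
  "w t i j = \<phi> (norm (x i t - x j t))"

definition force :: "nat \<Rightarrow> real \<Rightarrow> real ^ 'n" where
  "force i t = (\<sigma> * (\<theta> i t - norm (v i t) powr p)) *\<^sub>R v i t"

definition \<theta>m :: real where "\<theta>m = wmean (\<lambda>i. \<theta> i 0)"

abbreviation vm :: "real \<Rightarrow> real ^ 'n" where "vm t \<equiv> wmean (\<lambda>i. v i t)"

lemma w_sym: "w t i j = w t j i"
  by (simp add: w_def norm_minus_commute)

lemma w_ge: "c \<le> w t i j"
  by (simp add: w_def \<phi>)

lemma \<theta>m_pos: "\<theta>m > 0"
  unfolding \<theta>m_def wmean_def using mass_pos N m_pos \<theta>0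
  by (auto intro!: divide_pos_pos sum_pos simp: lessThan_empty_iff)

lemma v_deriv:
  assumes "i < N" "t \<ge> 0"
  shows "(v i has_vector_derivative (\<Sum>j<N. (m j * w t i j) *\<^sub>R (v j t - v i t)) + force i t)
    (at t within {0..})"
  using sol assms unfolding CSF_solution_def w_def force_def by blast

lemma \<theta>_deriv:
  assumes "i < N" "t \<ge> 0"
  shows "(\<theta> i has_vector_derivative \<kappa> *\<^sub>R (\<Sum>j<N. (m j * w t i j) *\<^sub>R (\<theta> j t - \<theta> i t)))
    (at t within {0..})"
  using sol assms unfolding CSF_solution_def w_def has_real_derivative_iff_has_vector_derivative
  by simp

section \<open>Conservation and relaxation of the \<theta> variables\<close>

lemma wmean_\<theta>:
  assumes "t \<ge> 0"
  shows "wmean (\<lambda>i. \<theta> i t) = \<theta>m"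
proof -
  have "((\<lambda>t. wmean (\<lambda>i. \<theta> i t)) has_vector_derivative 0) (at t within {0..})" if "t \<ge> 0" for t
    using wmean_has_vector_derivative[of \<theta>, OF \<theta>_deriv[OF _ that]]
    by (simp add: wmean_scaleR wmean_exchange[of "w t", OF w_sym] del: real_scaleR_def)
  then obtain k where "\<And>t. t \<in> {0..} \<Longrightarrow> wmean (\<lambda>i. \<theta> i t) = k"
    using has_vector_derivative_zero_constant[of "{0::real..}" "\<lambda>t. wmean (\<lambda>i. \<theta> i t)"] by auto
  then show ?thesis using assms unfolding \<theta>m_def by auto
qed

text \<open>The exchange dissipates the variance at rate 2 \<kappa> c times the mass, with no
  forcing. Conservation of the mean then identifies the common limit.\<close>

lemma \<theta>_decay:
  assumes "i < N"
  shows "exp_decay (\<lambda>t. \<theta> i t - \<theta>m)"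
proof -
  have "exp_decay (\<lambda>t. wvar (\<lambda>i. \<theta> i t))"
  proof (rule exp_decay_gronwall[OF _ order_refl _ exp_decay_zero])
    show "continuous_on {0..} (\<lambda>t. wvar (\<lambda>i. \<theta> i t))" by (rule continuous_wvar[OF \<theta>_deriv])
    show "0 < 2 * \<kappa> * c * mass" using \<kappa> c mass_pos by simp
    fix t :: real assume t: "t \<ge> 0"
    let ?S = "\<lambda>i. \<Sum>j<N. (m j * w t i j) *\<^sub>R (\<theta> j t - \<theta> i t)"
    show "((\<lambda>t. wvar (\<lambda>i. \<theta> i t)) has_real_derivative
        2 * (\<Sum>i<N. m i * inner (\<theta> i t - wmean (\<lambda>i. \<theta> i t)) (\<kappa> *\<^sub>R ?S i))) (at t within {0..})"
      using \<theta>_deriv t by (intro wvar_has_real_derivative) auto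
    have "(\<Sum>i<N. m i * inner (\<theta> i t - wmean (\<lambda>i. \<theta> i t)) (\<kappa> *\<^sub>R ?S i))
        = \<kappa> * (\<Sum>i<N. m i * inner (\<theta> i t - wmean (\<lambda>i. \<theta> i t)) (?S i))"
      by (simp only: inner_scaleR_right sum_distrib_left mult.left_commute)
    also have "\<dots> \<le> \<kappa> * - (c * mass * wvar (\<lambda>i. \<theta> i t))"
      using \<kappa> by (intro mult_left_mono exchange_dissipation w_sym w_ge) auto
    finally show "2 * (\<Sum>i<N. m i * inner (\<theta> i t - wmean (\<lambda>i. \<theta> i t)) (\<kappa> *\<^sub>R ?S i))
        \<le> - (2 * \<kappa> * c * mass) * wvar (\<lambda>i. \<theta> i t) + 0"
      by (simp add: mult_ac)
  qed (auto simp: wvar_nonneg)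
  from exp_decay_deviation[of \<theta>, OF this assms]
  show ?thesis by (rule exp_decay_dominated[where K = 1]) (simp add: wmean_\<theta>)
qed

lemma \<theta>_bounded:
  obtains \<Theta> where "\<Theta> > 0" "\<And>i t. i < N \<Longrightarrow> t \<ge> 0 \<Longrightarrow> \<bar>\<theta> i t\<bar> \<le> \<Theta>"
proof -
  \<comment> \<open>Summing over the particles produces one bound valid for every index.\<close>
  have "exp_decay (\<lambda>t. \<Sum>i<N. \<bar>\<theta> i t - \<theta>m\<bar>)"
    unfolding real_norm_def[symmetric] by (intro exp_decay_sum) (simp add: exp_decay_norm \<theta>_decay del: real_norm_def)
  then obtain C where C: "C > 0" "\<And>t. t \<ge> 0 \<Longrightarrow> norm (\<Sum>i<N. \<bar>\<theta> i t - \<theta>m\<bar>) \<le> C"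
    by (rule exp_decay_bounded) blast
  have "\<bar>\<theta> i t\<bar> \<le> C + \<theta>m" if "i < N" "t \<ge> 0" for i t
  proof -
    have "\<bar>\<theta> i t - \<theta>m\<bar> \<le> (\<Sum>i<N. \<bar>\<theta> i t - \<theta>m\<bar>)"
      using that by (intro member_le_sum[of i _ "\<lambda>i. \<bar>\<theta> i t - \<theta>m\<bar>"]) auto
    then show ?thesis using C(2)[OF that(2)] \<theta>m_pos by simp
  qed
  then show thesis using that[of "C + \<theta>m"] C \<theta>m_pos by auto
qed

section \<open>Velocity bounds and alignment\<close>

text \<open>In the balance of the energy \<open>E\<close> the exchange only dissipates, and the
  friction of order p + 2 overcomes the quadratic growth because the \<theta> variables are bounded.
  Gronwall then bounds \<open>E\<close>.\<close>

lemma v_bounded: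
  obtains B where "B > 0" "\<And>i t. i < N \<Longrightarrow> t \<ge> 0 \<Longrightarrow> norm (v i t) \<le> B"
proof -
  obtain \<Theta> where \<Theta>: "\<Theta> > 0" "\<And>i t. i < N \<Longrightarrow> t \<ge> 0 \<Longrightarrow> \<bar>\<theta> i t\<bar> \<le> \<Theta>"
    using \<theta>_bounded by blast
  \<comment> \<open>\<open>L\<close> bounds (\<Theta> + 1 - s^p) s^2: where the first factor is
    nonnegative, s is at most (\<Theta> + 1)^(1/p). The extra 1 yields the damping term
    -s^2.\<close>
  define L where "L = (\<Theta> + 1) * ((\<Theta> + 1) powr (1/p))\<^sup>2"
  have L: "0 \<le> L" using \<Theta> by (simp add: L_def)
  have pointwise: "(a - s powr p) * s\<^sup>2 \<le> L - s\<^sup>2" if "s \<ge> 0" "\<bar>a\<bar> \<le> \<Theta>" for a s :: real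
  proof -
    have "(a - s powr p) * s\<^sup>2 + s\<^sup>2 = (a + 1 - s powr p) * s\<^sup>2" by (simp add: algebra_simps)
    also have "\<dots> \<le> (\<Theta> + 1 - s powr p) * s\<^sup>2" using that by (intro mult_right_mono) auto
    also have "\<dots> \<le> L"
    proof (cases "s powr p \<le> \<Theta> + 1")
      case True
      then have "(s powr p) powr (1/p) \<le> (\<Theta> + 1) powr (1/p)" using p by (intro powr_mono2) auto
      then have "s \<le> (\<Theta> + 1) powr (1/p)" using that p by (simp add: powr_powr split: if_splits)
      then show ?thesis unfolding L_def using that True \<Theta>
        by (intro mult_mono power_mono) auto
    next
      case False
      then have "(\<Theta> + 1 - s powr p) * s\<^sup>2 \<le> 0" by (intro mult_nonpos_nonneg) auto
      then show ?thesis using L by linarith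
    qed
    finally show ?thesis by linarith
  qed
  define E where "E = (\<lambda>t. \<Sum>i<N. m i * (norm (v i t))\<^sup>2)"
  define E' where "E' = (\<lambda>t. \<Sum>i<N. m i *
    (2 * inner (v i t) ((\<Sum>j<N. (m j * w t i j) *\<^sub>R (v j t - v i t)) + force i t)))"
  have dE: "(E has_real_derivative E' t) (at t within {0..})" if "t \<ge> 0" for t
    unfolding E_def E'_def using that
    by (intro DERIV_sum DERIV_cmult has_real_derivative_norm_power2 v_deriv) auto
  \<comment> \<open>The factor \<open>exp (- 0 * t)\<close> casts the constant forcing as the case b
    = 0 of \<open>gronwall_exp\<close>.\<close>
  have leE: "E' t \<le> - (2 * \<sigma>) * E t + 2 * \<sigma> * L * mass * exp (- 0 * t)" if t: "t \<ge> 0" for t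
  proof -
    \<comment> \<open>Writing \<open>v i t - 0\<close> matches \<open>exchange_dissipation\<close>
      with the shift y = 0.\<close>
    have "E' t = 2 * (\<Sum>i<N. m i * inner (v i t - 0) (\<Sum>j<N. (m j * w t i j) *\<^sub>R (v j t - v i t)))
        + 2 * (\<Sum>i<N. m i * inner (v i t) (force i t))"
      unfolding E'_def sum_distrib_left sum.distrib[symmetric]
      by (intro sum.cong refl) (simp add: inner_add_right algebra_simps)
    also have "(\<Sum>i<N. m i * inner (v i t - 0) (\<Sum>j<N. (m j * w t i j) *\<^sub>R (v j t - v i t)))
        \<le> - (c * mass * wvar (\<lambda>i. v i t))"
      by (intro exchange_dissipation w_sym w_ge)
    also have "- (c * mass * wvar (\<lambda>i. v i t)) \<le> 0"
      using c mass_pos wvar_nonneg[of "\<lambda>i. v i t"] by simp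
    also have "(\<Sum>i<N. m i * inner (v i t) (force i t)) \<le> (\<Sum>i<N. m i * (\<sigma> * (L - (norm (v i t))\<^sup>2)))"
    proof (intro sum_mono mult_left_mono)
      fix i assume i: "i \<in> {..<N}"
      have "inner (v i t) (force i t) = \<sigma> * ((\<theta> i t - norm (v i t) powr p) * (norm (v i t))\<^sup>2)"
        by (simp add: force_def power2_norm_eq_inner)
      also have "\<dots> \<le> \<sigma> * (L - (norm (v i t))\<^sup>2)"
        using \<sigma> \<Theta>(2) t i by (intro mult_left_mono pointwise) auto
      finally show "inner (v i t) (force i t) \<le> \<sigma> * (L - (norm (v i t))\<^sup>2)" .
    qed (use m_pos in \<open>auto simp: less_imp_le\<close>)
    also have "\<dots> = \<sigma> * L * mass - \<sigma> * E t"
      unfolding E_def mass_def sum_distrib_left sum_subtractf[symmetric]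
      by (intro sum.cong) (auto simp: algebra_simps)
    finally show ?thesis by (simp add: algebra_simps)
  qed
  define D where "D = exp (2 * \<sigma> * 0) * \<bar>E 0\<bar> + 2 * \<sigma> * L * mass / (2 * \<sigma> - 0)"
  have "E t \<le> D * exp (- 0 * t)" if "t \<ge> 0" for t
    unfolding D_def
    by (rule gronwall_exp[OF order_refl _ _ _ dE leE that]) (use \<sigma> L mass_pos in auto)
  then have E: "E t \<le> D" if "t \<ge> 0" for t using that by simp
  have sq: "norm (v i t) \<le> sqrt (D / m i)" if "i < N" "t \<ge> 0" for i t
  proof -
    have "m i * (norm (v i t))\<^sup>2 \<le> E t"
      unfolding E_def using that m_pos
      by (intro member_le_sum[of i _ "\<lambda>i. m i * (norm (v i t))\<^sup>2"]) (auto simp: less_imp_le)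
    then have "(norm (v i t))\<^sup>2 \<le> D / m i"
      using E[OF that(2)] m_pos[OF that(1)] by (simp add: field_simps)
    then show ?thesis by (rule real_le_rsqrt)
  qed
  have "D \<ge> 0" using \<sigma> L mass_pos by (simp add: D_def)
  have "norm (v i t) \<le> 1 + (\<Sum>i<N. sqrt (D / m i))" if "i < N" "t \<ge> 0" for i t
  proof -
    have "sqrt (D / m i) \<le> (\<Sum>i<N. sqrt (D / m i))"
      using that m_pos \<open>D \<ge> 0\<close>
      by (intro member_le_sum[of i _ "\<lambda>i. sqrt (D / m i)"]) (auto simp: less_imp_le)
    then show ?thesis using sq[OF that] by simp
  qed
  moreover have "(\<Sum>i<N. sqrt (D / m i)) \<ge> 0"
    using m_pos \<open>D \<ge> 0\<close> by (intro sum_nonneg) (auto simp: less_imp_le)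
  ultimately show thesis using that[of "1 + (\<Sum>i<N. sqrt (D / m i))"] by auto
qed

lemma v_align:
  assumes "i < N"
  shows "exp_decay (\<lambda>t. v i t - vm t)"
proof -
  obtain B where B: "B > 0" "\<And>i t. i < N \<Longrightarrow> t \<ge> 0 \<Longrightarrow> norm (v i t) \<le> B"
    using v_bounded by blast
  have vm: "norm (vm t) \<le> B" if "t \<ge> 0" for t using B that by (intro norm_wmean_le) auto
  \<comment> \<open>\<open>h\<close> is the cost of replacing each \<theta>_i by the conserved mean
    in the variance balance; it inherits exponential decay from \<theta>_i since the velocities are
    bounded.\<close>
  define h where "h = (\<lambda>t. \<Sum>i<N. (2 * \<sigma> * m i * inner (v i t - vm t) (v i t)) *\<^sub>R (\<theta> i t - \<theta>m))"
  have "exp_decay (\<lambda>t. wvar (\<lambda>i. v i t))"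
  proof (rule exp_decay_gronwall[OF _ order_refl])
    show "continuous_on {0..} (\<lambda>t. wvar (\<lambda>i. v i t))" by (rule continuous_wvar[OF v_deriv])
    show "0 < 2 * (c * mass - \<sigma> * \<theta>m)" using strong by (simp add: \<theta>m_def)
    show "exp_decay h"
      unfolding h_def
    proof (intro exp_decay_sum exp_decay_scaleR_left)
      fix i assume i: "i \<in> {..<N}"
      then show "exp_decay (\<lambda>t. \<theta> i t - \<theta>m)" using \<theta>_decay by auto
      fix t :: real assume t: "t \<ge> 0"
      have "norm (v i t - vm t) \<le> 2 * B"
        using norm_triangle_ineq4[of "v i t" "vm t"] B(2)[of i t] vm[OF t] i t by auto
      then have "\<bar>inner (v i t - vm t) (v i t)\<bar> \<le> (2 * B) * B"
        using B(1) B(2)[of i t] i t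
        by (intro order_trans[OF Cauchy_Schwarz_ineq2] mult_mono) auto
      then show "\<bar>2 * \<sigma> * m i * inner (v i t - vm t) (v i t)\<bar> \<le> 2 * \<sigma> * m i * (2 * B * B)"
        unfolding abs_mult[of "2 * \<sigma> * m i"] using \<sigma> m_pos[of i] i
        by (intro mult_mono) auto
    qed
    fix t :: real assume t: "t \<ge> 0"
    let ?S = "\<lambda>i. \<Sum>j<N. (m j * w t i j) *\<^sub>R (v j t - v i t)"
    show "((\<lambda>t. wvar (\<lambda>i. v i t)) has_real_derivative
        2 * (\<Sum>i<N. m i * inner (v i t - vm t) (?S i + force i t))) (at t within {0..})"
      using v_deriv t by (intro wvar_has_real_derivative) auto
    have exch: "(\<Sum>i<N. m i * inner (v i t - vm t) (?S i)) \<le> - (c * mass * wvar (\<lambda>i. v i t))"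
      by (intro exchange_dissipation w_sym w_ge)
    \<comment> \<open>The field at the mean velocity does not depend on \<open>i\<close>, so it can
      be subtracted at no cost; monotonicity then applies term by term and gives the friction a
      favourable sign.\<close>
    have "(\<Sum>i<N. m i * inner (v i t - vm t) ((norm (v i t) powr p) *\<^sub>R v i t))
        = (\<Sum>i<N. m i * inner (v i t - vm t) ((norm (v i t) powr p) *\<^sub>R v i t))
          - (\<Sum>i<N. m i * inner (v i t - vm t) ((norm (vm t) powr p) *\<^sub>R vm t))"
      by (subst sum_deviation) simp
    also have "\<dots> = (\<Sum>i<N. m i * inner (v i t - vm t)
        ((norm (v i t) powr p) *\<^sub>R v i t - (norm (vm t) powr p) *\<^sub>R vm t))"
      unfolding sum_subtractf[symmetric]
      by (intro sum.cong refl) (simp only: inner_diff_right right_diff_distrib)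
    also have "\<dots> \<ge> 0"
      using m_pos p by (intro sum_nonneg mult_nonneg_nonneg powr_field_monotone) (auto simp: less_imp_le)
    finally have mono: "0 \<le> (\<Sum>i<N. m i * inner (v i t - vm t) ((norm (v i t) powr p) *\<^sub>R v i t))" .
    have "2 * (\<Sum>i<N. m i * inner (v i t - vm t) (?S i + force i t))
        = 2 * (\<Sum>i<N. m i * inner (v i t - vm t) (?S i))
          + 2 * (\<Sum>i<N. m i * inner (v i t - vm t) (force i t))"
      by (simp only: inner_add_right distrib_left sum.distrib)
    \<comment> \<open>Split \<theta>_i into its mean and its deviation. By \<open>wvar_eq\<close>
      the mean part is a multiple of the variance, and the deviation part is
      \<open>h\<close>.\<close>
    also have "2 * (\<Sum>i<N. m i * inner (v i t - vm t) (force i t))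
        = 2 * \<sigma> * \<theta>m * wvar (\<lambda>i. v i t) + h t
          - 2 * \<sigma> * (\<Sum>i<N. m i * inner (v i t - vm t) ((norm (v i t) powr p) *\<^sub>R v i t))"
      unfolding wvar_eq h_def force_def sum_distrib_left sum.distrib[symmetric] sum_subtractf[symmetric]
      by (intro sum.cong refl) (simp add: algebra_simps)
    also have "\<dots> \<le> 2 * \<sigma> * \<theta>m * wvar (\<lambda>i. v i t) + h t"
      using mono \<sigma> by simp
    finally show "2 * (\<Sum>i<N. m i * inner (v i t - vm t) (?S i + force i t))
        \<le> - (2 * (c * mass - \<sigma> * \<theta>m)) * wvar (\<lambda>i. v i t) + h t"
      using exch by (simp add: algebra_simps)
  qed (auto simp: wvar_nonneg)
  then show ?thesis using assms by (rule exp_decay_deviation)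
qed

section \<open>Reduction to the mean velocity\<close>

lemma vm_perturbed_rayleigh:
  obtains R where "exp_decay R"
    "\<And>t. t \<ge> 0 \<Longrightarrow> (vm has_vector_derivative
        (\<sigma> * (\<theta>m - norm (vm t) powr p)) *\<^sub>R vm t + R t) (at t within {0..})"
proof -
  obtain B where B: "B > 0" "\<And>i t. i < N \<Longrightarrow> t \<ge> 0 \<Longrightarrow> norm (v i t) \<le> B"
    using v_bounded by blast
  have vm: "norm (vm t) \<le> B" if "t \<ge> 0" for t using B that by (intro norm_wmean_le) auto
  \<comment> \<open>Two errors arise when the force on particle \<open>i\<close> is compared with
    the Rayleigh field: the deviation of \<theta>_i, and the friction evaluated at
    \<open>v i\<close> instead of the mean. The remainder \<open>R\<close> is the weighted mean of
    the \<open>q i\<close>.\<close>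
  define q where "q = (\<lambda>i t. \<sigma> *\<^sub>R ((\<theta> i t - \<theta>m) *\<^sub>R v i t
      + - ((norm (v i t) powr p) *\<^sub>R v i t - (norm (vm t) powr p) *\<^sub>R vm t)))"
  have "exp_decay (q i)" if i: "i < N" for i
  proof -
    have 1: "exp_decay (\<lambda>t. (\<theta> i t - \<theta>m) *\<^sub>R v i t)"
      using \<theta>_decay[OF i]
    proof (rule exp_decay_dominated)
      show "norm ((\<theta> i t - \<theta>m) *\<^sub>R v i t) \<le> B * norm (\<theta> i t - \<theta>m)" if "t \<ge> 0" for t
        using B(2)[OF i that] mult_left_mono[of "norm (v i t)" B "\<bar>\<theta> i t - \<theta>m\<bar>"] by (simp add: mult_ac)
    qed
    have 2: "exp_decay (\<lambda>t. - ((norm (v i t) powr p) *\<^sub>R v i t - (norm (vm t) powr p) *\<^sub>R vm t))"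
      using v_align[OF i]
    proof (rule exp_decay_dominated)
      show "norm (- ((norm (v i t) powr p) *\<^sub>R v i t - (norm (vm t) powr p) *\<^sub>R vm t))
          \<le> (p + 1) * B powr p * norm (v i t - vm t)" if "t \<ge> 0" for t
        unfolding norm_minus_cancel using p B(2)[OF i that] vm[OF that] by (rule powr_field_lipschitz)
    qed
    show ?thesis unfolding q_def
      using exp_decay_add[OF 1 2] by (rule exp_decay_scaleR_left) (rule order_refl)
  qed
  then have "exp_decay (\<lambda>t. wmean (\<lambda>i. q i t))"
    unfolding wmean_def
    by (intro exp_decay_scaleR_left[OF _ order_refl] exp_decay_sum) auto
  moreover have "(vm has_vector_derivative
      (\<sigma> * (\<theta>m - norm (vm t) powr p)) *\<^sub>R vm t + wmean (\<lambda>i. q i t)) (at t within {0..})" if t: "t \<ge> 0" for t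
  proof -
    have "(vm has_vector_derivative
        wmean (\<lambda>i. (\<Sum>j<N. (m j * w t i j) *\<^sub>R (v j t - v i t)) + force i t)) (at t within {0..})"
      using v_deriv t by (intro wmean_has_vector_derivative) auto
    also have "wmean (\<lambda>i. (\<Sum>j<N. (m j * w t i j) *\<^sub>R (v j t - v i t)) + force i t)
        = wmean (\<lambda>i. force i t)"
      by (simp only: wmean_add wmean_exchange[of "w t", OF w_sym] add_0)
    also have "(\<lambda>i. force i t) = (\<lambda>i. (\<sigma> * \<theta>m) *\<^sub>R v i t - (\<sigma> * norm (vm t) powr p) *\<^sub>R vm t + q i t)"
      by (auto simp: fun_eq_iff force_def q_def algebra_simps)
    also have "wmean (\<lambda>i. (\<sigma> * \<theta>m) *\<^sub>R v i t - (\<sigma> * norm (vm t) powr p) *\<^sub>R vm t + q i t)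
        = (\<sigma> * (\<theta>m - norm (vm t) powr p)) *\<^sub>R vm t + wmean (\<lambda>i. q i t)"
      by (simp only: wmean_add wmean_diff wmean_scaleR wmean_const) (simp add: algebra_simps)
    finally show ?thesis .
  qed
  ultimately show thesis using that by blast
qed

text \<open>By alignment, convergence of the mean velocity to 0 would force every velocity to 0. So
  the mean falls under \<open>rayleigh_dichotomy\<close>, and alignment transfers its limit back to
  the particles.\<close>

lemma v_limit:
  assumes "\<not> (\<forall>i<N. (v i \<longlongrightarrow> 0) at_top)"
  obtains l where "norm l = \<theta>m powr (1/p)" "\<And>i. i < N \<Longrightarrow> exp_decay (\<lambda>t. v i t - l)"
proof -
  obtain R where R: "exp_decay R" "\<And>t. t \<ge> 0 \<Longrightarrow> (vm has_vector_derivative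
        (\<sigma> * (\<theta>m - norm (vm t) powr p)) *\<^sub>R vm t + R t) (at t within {0..})"
    using vm_perturbed_rayleigh by blast
  obtain B where B: "B > 0" "\<And>i t. i < N \<Longrightarrow> t \<ge> 0 \<Longrightarrow> norm (v i t) \<le> B"
    using v_bounded by blast
  have vm: "norm (vm t) \<le> B" if "t \<ge> 0" for t using B that by (intro norm_wmean_le) auto
  have "\<not> (vm \<longlongrightarrow> 0) at_top"
  proof
    assume "(vm \<longlongrightarrow> 0) at_top"
    then have "((\<lambda>t. (v i t - vm t) + vm t) \<longlongrightarrow> 0 + 0) at_top" if "i < N" for i
      using exp_decay_tendsto_0[OF v_align[OF that]] by (intro tendsto_add)
    then show False using assms by simp
  qed
  then obtain l where l: "norm l = \<theta>m powr (1/p)" "exp_decay (\<lambda>t. vm t - l)"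
    using rayleigh_dichotomy[OF \<sigma> p \<theta>m_pos R(2) R(1) vm] by blast
  have "exp_decay (\<lambda>t. v i t - l)" if "i < N" for i
    using exp_decay_add[OF v_align[OF that] l(2)] by simp
  then show thesis using l that by blast
qed

text \<open>Every pairwise difference passes through the mean, and the sum of all deviations gives a
  constant and a rate common to all pairs.\<close>

lemma diameter_decay:
  "\<exists>C rate. rate > 0 \<and> (\<forall>t\<ge>0. Max {norm (v i t - v j t) | i j. i < N \<and> j < N} \<le> C * exp (- rate * t))"
proof -
  have "exp_decay (\<lambda>t. \<Sum>i<N. norm (v i t - vm t))"
    using v_align by (intro exp_decay_sum) (auto simp: exp_decay_norm)
  then obtain C r where *: "C > 0" "r > 0"
    "\<And>t. t \<ge> 0 \<Longrightarrow> norm (\<Sum>i<N. norm (v i t - vm t)) \<le> C * exp (- r * t)"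
    using exp_decayE by blast
  have "Max {norm (v i t - v j t) | i j. i < N \<and> j < N} \<le> (2 * C) * exp (- r * t)" if t: "t \<ge> 0" for t
  proof (rule Max.boundedI)
    have eq: "{norm (v i t - v j t) | i j. i < N \<and> j < N} = (\<lambda>(i, j). norm (v i t - v j t)) ` ({..<N} \<times> {..<N})"
      by auto
    show "finite {norm (v i t - v j t) | i j. i < N \<and> j < N}" unfolding eq by simp
    show "{norm (v i t - v j t) | i j. i < N \<and> j < N} \<noteq> {}"
      using N unfolding eq by (auto simp: lessThan_empty_iff)
    have dev: "norm (v i t - vm t) \<le> C * exp (- r * t)" if "i < N" for i
    proof -
      have "norm (v i t - vm t) \<le> (\<Sum>i<N. norm (v i t - vm t))"
        using that by (intro member_le_sum[of i _ "\<lambda>i. norm (v i t - vm t)"]) auto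
      then show ?thesis using *(3)[OF t] by simp
    qed
    fix a assume "a \<in> {norm (v i t - v j t) | i j. i < N \<and> j < N}"
    then obtain i j where ij: "i < N" "j < N" "a = norm (v i t - v j t)" by auto
    then have "a \<le> norm (v i t - vm t) + norm (v j t - vm t)"
      using norm_triangle_ineq4[of "v i t - vm t" "v j t - vm t"] by simp
    then show "a \<le> (2 * C) * exp (- r * t)" using dev[OF ij(1)] dev[OF ij(2)] by simp
  qed
  then show ?thesis using *(2) by blast
qed

end

section \<open>Assembly of the dichotomy\<close>

theorem theorem3p3:
  fixes N :: nat and m :: "nat \<Rightarrow> real" and \<sigma> p \<kappa> :: real and \<phi> :: "real \<Rightarrow> real"
    and x v :: "nat \<Rightarrow> real \<Rightarrow> real ^ 'n" and \<theta> :: "nat \<Rightarrow> real \<Rightarrow> real"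
  assumes N: "N \<ge> 1"
    and m_pos: "\<forall>i<N. m i > 0"
    and \<sigma>: "\<sigma> > 0" and p: "p > 0" and \<kappa>: "\<kappa> > 0"
    and \<phi>: "comm_kernel \<phi>"
    and \<phi>_inf: "Inf (\<phi> ` {0..}) > 0"
    and cond: "Inf (\<phi> ` {0..}) * (\<Sum>i<N. m i) > \<sigma> * ((\<Sum>i<N. m i * \<theta> i 0) / (\<Sum>i<N. m i))"
    and \<theta>0: "\<forall>i<N. \<theta> i 0 > 0"
    and sol: "CSF_solution N m \<sigma> p \<kappa> \<phi> x v \<theta>"
  shows "(\<exists>C rate. rate > 0 \<and> (\<forall>t\<ge>0.
            Max {norm (v i t - v j t) | i j. i < N \<and> j < N} \<le> C * exp (- rate * t)))
       \<and> ((\<forall>i<N. (v i \<longlongrightarrow> 0) at_top) \<noteq>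
          (\<exists>vbar :: real ^ 'n.
             norm vbar = ((\<Sum>i<N. m i * \<theta> i 0) / (\<Sum>i<N. m i)) powr (1 / p) \<and>
             (\<exists>C rate. rate > 0 \<and> (\<forall>i<N. \<forall>t\<ge>0. norm (v i t - vbar) \<le> C * exp (- rate * t)))))"
proof -
  interpret weights N m using N m_pos by unfold_locales auto
  have mean: "(\<Sum>i<N. m i * \<theta> i 0) / (\<Sum>i<N. m i) = wmean (\<lambda>i. \<theta> i 0)"
    by (simp add: wmean_def mass_def)
  \<comment> \<open>Positivity of the kernel bounds its range from below, which makes the infimum a
    genuine lower bound and an admissible \<open>c\<close>.\<close>
  have "bdd_below (\<phi> ` {0..})"
    using \<phi> by (intro bdd_belowI[of _ 0]) (auto simp: comm_kernel_def less_imp_le)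
  then have "Inf (\<phi> ` {0..}) \<le> \<phi> r" if "r \<ge> 0" for r
    using that by (intro cInf_lower) auto
  then interpret csf N m \<sigma> p \<kappa> "Inf (\<phi> ` {0..})" \<phi> x v \<theta>
    using \<sigma> p \<kappa> \<phi>_inf cond \<theta>0 sol unfolding mean by unfold_locales (auto simp: mass_def)
  let ?conv = "\<lambda>l. \<exists>C rate. rate > 0 \<and> (\<forall>i<N. \<forall>t\<ge>0. norm (v i t - l) \<le> C * exp (- rate * t))"
  \<comment> \<open>Particle 0 exists because N \<ge> 1; its two limits would agree, yet |l| =
    \<theta>m^(1/p) is positive.\<close>
  have excl: False
    if 0: "\<forall>i<N. (v i \<longlongrightarrow> 0) at_top" and l: "norm l = \<theta>m powr (1/p)" "?conv l" for l
  proof -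
    have "exp_decay (\<lambda>t. v 0 t - l)" using l(2) N unfolding exp_decay_def by force
    then have "(v 0 \<longlongrightarrow> l) at_top" using exp_decay_tendsto_0 LIM_zero_iff by blast
    then have "l = 0" using 0 N by (intro tendsto_unique[of at_top "v 0"]) auto
    then show False using l \<theta>m_pos by simp
  qed
  have "\<exists>l. norm l = \<theta>m powr (1/p) \<and> ?conv l" if not0: "\<not> (\<forall>i<N. (v i \<longlongrightarrow> 0) at_top)"
  proof -
    obtain l where l: "norm l = \<theta>m powr (1/p)" "\<And>i. i < N \<Longrightarrow> exp_decay (\<lambda>t. v i t - l)"
      using v_limit[OF not0] by blast
    \<comment> \<open>The conclusion asks for one constant and one rate for all particles, obtained
      by summing the individual decays.\<close>
    then have "exp_decay (\<lambda>t. \<Sum>i<N. norm (v i t - l))"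
      by (intro exp_decay_sum) (auto simp: exp_decay_norm)
    then obtain C r where *: "C > 0" "r > 0"
      "\<And>t. t \<ge> 0 \<Longrightarrow> norm (\<Sum>i<N. norm (v i t - l)) \<le> C * exp (- r * t)"
      using exp_decayE by blast
    have "norm (v i t - l) \<le> C * exp (- r * t)" if "i < N" "t \<ge> 0" for i t
    proof -
      have "norm (v i t - l) \<le> (\<Sum>i<N. norm (v i t - l))"
        using that by (intro member_le_sum[of i _ "\<lambda>i. norm (v i t - l)"]) auto
      then show ?thesis using *(3)[OF that(2)] by simp
    qed
    then show ?thesis using l * by blast
  qed
  then show ?thesis
    using diameter_decay excl unfolding mean \<theta>m_def by blast
qed

end
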